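(* Let $u^0\in\mathbb{M}_h$ satisfy $\|u^0\|_\infty\le\beta$, and suppose $$0<\tau\le\min\Big\{\frac{h^2}{\kappa h^2+2\varepsilon^2},\ \frac{1}{\kappa+\|f'\|_{C[-\beta,\beta]}}\Big\}.$$ Then the solution generated from $u^0$ by the ESS1-adjoint method with time step $\tau$ satisfies $$E_h(u^{n+1})\le E_h(u^n),\qquad 0\le n\le N_t-1.$$
   Context: Problem: the two-dimensional Allen-Cahn equation $u_t=\varepsilon^2\Delta u+f(u)$ on $\Omega=(0,2\pi)^2$ with periodic boundary conditions, $t\in(0,T]$, $T>0$, $\varepsilon>0$. Assumptions on $f$: $\beta>0$ is a constant, $f$ is a real-valued function on an interval containing $[-\beta,\beta]$, continuously differentiable on $[-\beta,\beta]$; $f$ is odd and $f(\beta)=0$. $F$ is a bulk potential with $F'=-f$. Write $\|f'\|_{C[-\beta,\beta]}=\max_{\xi\in[-\beta,\beta]}|f'(\xi)|$. Grid: $M$ is a positive integer, $h=2\pi/M$. $\mathbb{M}_h$ is the space of real grid functions $v=(v_{ij})_{0\le i,j\le M-1}$ (indices extended periodically mod $M$), identified with $M\times M$ real matrices, with $\|v\|_\infty=\max_{i,j}|v_{ij}|$, $\langle v,w\rangle=h^2\sum_{i,j=0}^{M-1}v_{ij}w_{ij}$, $\|v\|=\sqrt{\langle v,v\rangle}$. The discrete gradient is $\nabla_hv_{ij}=\big(\frac{v_{i+1,j}-v_{ij}}{h},\frac{v_{i,j+1}-v_{ij}}{h}\big)^{\mathrm T}$, and for pairs $\bm v=(v^1,v^2)$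 of grid functions $\|\bm v\|^2=\|v^1\|^2+\|v^2\|^2$. The discrete energy is $E_h(v)=\frac{\varepsilon^2}{2}\|\nabla_hv\|^2+\langle F(v),1\rangle$, with $F$ acting entrywise. $\tau>0$ is the time step, $t_n=n\tau$, $N_t=\lfloor T/\tau\rfloor$. Operators: $D_a$ is the $M\times M$ matrix (indices $0,\dots,M-1$) equal to $h^{-2}$ times the matrix with $-1$ on the diagonal, $1$ at positions $(i,i+1)$ for $0\le i\le M-2$, $1$ at position $(0,M-1)$, and zeros elsewhere (contributions at coinciding positions are added when $M\le 2$). $D_b=D_a^{\mathrm T}$. For $v\in\mathbb{M}_h$ set $\varDelta_a v=D_av+vD_a^{\mathrm T}$ and $\varDelta_b v=D_bv+vD_b^{\mathrm T}$. ESS1-adjoint method with stabilization parameter $\kappa\ge 0$: $f$ acts entrywise, and $u^{n+1}$ is the solution, given $u^n$, of $$\frac{u^{n+1}-u^n}{\tau}=\varepsilon^2(\varDelta_au^{n+1}+\varDelta_bu^{n})+f(u^{n+1})+\kappa(u^{n+1}-u^n)$$ with all entries in $[-\beta,\beta]$ (unique under the stated time step restriction). The quantity $1/(\kappa+\|f'\|_{C[-\beta,\beta]})$ is read as $+\infty$ if its denominator vanishes. *)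

theory Defs
  imports "HOL-Analysis.Analysis" "Jordan_Normal_Form.Matrix"
begin

text \<open>
  A real grid function on the periodic \<open>M \<times> M\<close> grid is an element of \<^term>\<open>carrier_mat M M\<close>
  over the reals; its entries are numbered from \<open>0\<close> to \<open>M - 1\<close>.
\<close>

definition mesh :: "nat \<Rightarrow> real" where
  "mesh M = 2 * pi / real M"

definition grid_sup_norm :: "nat \<Rightarrow> real mat \<Rightarrow> real" where
  "grid_sup_norm M v = Max ((\<lambda>(i, j). \<bar>v $$ (i, j)\<bar>) ` ({..<M} \<times> {..<M}))"

definition grid_inner :: "nat \<Rightarrow> real mat \<Rightarrow> real mat \<Rightarrow> real" where
  "grid_inner M v w = (mesh M)\<^sup>2 * (\<Sum>i<M. \<Sum>j<M. v $$ (i, j) * w $$ (i, j))"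

definition grid_norm :: "nat \<Rightarrow> real mat \<Rightarrow> real" where
  "grid_norm M v = sqrt (grid_inner M v v)"

definition grid_pair_norm :: "nat \<Rightarrow> real mat \<times> real mat \<Rightarrow> real" where
  "grid_pair_norm M p = sqrt ((grid_norm M (fst p))\<^sup>2 + (grid_norm M (snd p))\<^sup>2)"

definition grid_gradient :: "nat \<Rightarrow> real mat \<Rightarrow> real mat \<times> real mat" where
  "grid_gradient M v =
     (mat M M (\<lambda>(i, j). (v $$ ((i + 1) mod M, j) - v $$ (i, j)) / mesh M),
      mat M M (\<lambda>(i, j). (v $$ (i, (j + 1) mod M) - v $$ (i, j)) / mesh M))"

definition grid_energy :: "nat \<Rightarrow> real \<Rightarrow> (real \<Rightarrow> real) \<Rightarrow> real mat \<Rightarrow> real" where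
  "grid_energy M \<epsilon> F v =
     \<epsilon>\<^sup>2 / 2 * (grid_pair_norm M (grid_gradient M v))\<^sup>2
     + grid_inner M (map_mat F v) (mat M M (\<lambda>_. 1))"

text \<open>
  The corner entry sits at position \<open>(0, M - 1)\<close>, so that \<open>D_a\<close> is upper triangular (it is not
  the periodic forward difference), while \<open>D_a + D_b\<close> is the periodic second difference.
  Writing the entries as a sum adds the contributions at coinciding positions when \<open>M \<le> 2\<close>.
\<close>

definition D_a :: "nat \<Rightarrow> real mat" where
  "D_a M = (1 / (mesh M)\<^sup>2) \<cdot>\<^sub>m mat M M (\<lambda>(i, j).
     (if i = j then -1 else 0) + (if j = i + 1 then 1 else 0)
     + (if i = 0 \<and> j = M - 1 then 1 else 0))"

definition D_b :: "nat \<Rightarrow> real mat" where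
  "D_b M = transpose_mat (D_a M)"

definition Delta_a :: "nat \<Rightarrow> real mat \<Rightarrow> real mat" where
  "Delta_a M v = D_a M * v + v * transpose_mat (D_a M)"

definition Delta_b :: "nat \<Rightarrow> real mat \<Rightarrow> real mat" where
  "Delta_b M v = D_b M * v + v * transpose_mat (D_b M)"

definition ess1_adjoint_step ::
  "nat \<Rightarrow> real \<Rightarrow> (real \<Rightarrow> real) \<Rightarrow> real \<Rightarrow> real \<Rightarrow> real \<Rightarrow> real mat \<Rightarrow> real mat \<Rightarrow> bool" where
  "ess1_adjoint_step M \<epsilon> f \<beta> \<kappa> \<tau> v w \<longleftrightarrow>
     w \<in> carrier_mat M M \<and>
     (\<forall>i<M. \<forall>j<M. w $$ (i, j) \<in> {-\<beta>..\<beta>}) \<and>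
     (1 / \<tau>) \<cdot>\<^sub>m (w - v) =
       \<epsilon>\<^sup>2 \<cdot>\<^sub>m (Delta_a M w + Delta_b M v) + map_mat f w + \<kappa> \<cdot>\<^sub>m (w - v)"

definition ess1_adjoint_solution ::
  "nat \<Rightarrow> real \<Rightarrow> (real \<Rightarrow> real) \<Rightarrow> real \<Rightarrow> real \<Rightarrow> real \<Rightarrow> nat \<Rightarrow> real mat \<Rightarrow> (nat \<Rightarrow> real mat) \<Rightarrow> bool"
  where
  "ess1_adjoint_solution M \<epsilon> f \<beta> \<kappa> \<tau> N u0 u \<longleftrightarrow>
     u 0 = u0 \<and> (\<forall>n<N. ess1_adjoint_step M \<epsilon> f \<beta> \<kappa> \<tau> (u n) (u (Suc n)))"

definition interval_sup_norm :: "real \<Rightarrow> (real \<Rightarrow> real) \<Rightarrow> real" where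
  "interval_sup_norm \<beta> g = (SUP \<xi>\<in>{-\<beta>..\<beta>}. \<bar>g \<xi>\<bar>)"

text \<open>
  Here \<open>L\<close> stands for the sup norm of \<open>f'\<close>; \<open>1 / (\<kappa> + L)\<close> is read as infinity when its
  denominator vanishes, and then drops out of the minimum.
\<close>

definition max_time_step :: "nat \<Rightarrow> real \<Rightarrow> real \<Rightarrow> real \<Rightarrow> real" where
  "max_time_step M \<epsilon> \<kappa> L =
     (let a = (mesh M)\<^sup>2 / (\<kappa> * (mesh M)\<^sup>2 + 2 * \<epsilon>\<^sup>2)
      in if \<kappa> + L = 0 then a else min a (1 / (\<kappa> + L)))"

end

theory Submission
  imports Defs
begin

text \<open>
  The step is a discrete-gradient method for the quadratic part of the energy. The operators
  \<open>\<Delta>\<^sub>a\<close> and \<open>\<Delta>\<^sub>b\<close> are adjoint to each other and add up to the periodic discrete Laplacian, so the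
  Dirichlet energy of \<open>v\<close> is \<open>- \<epsilon>\<^sup>2 \<langle>\<Delta>\<^sub>a v, v\<rangle>\<close> (\<open>grid_gradient_norm_eq\<close>), and for \<open>\<delta> = w - v\<close>
  the cross terms in \<open>\<langle>\<Delta>\<^sub>a w + \<Delta>\<^sub>b v, \<delta>\<rangle>\<close> cancel exactly, leaving
  \<open>\<langle>\<Delta>\<^sub>a w, w\<rangle> - \<langle>\<Delta>\<^sub>a v, v\<rangle>\<close> (\<open>Delta_telescope\<close>): treating one triangular half implicitly and the other
  explicitly makes no error in the energy balance.

  For the bulk potential, \<open>f\<close> is Lipschitz on \<open>[-\<beta>, \<beta>]\<close> with constant \<open>L = \<parallel>f'\<parallel>\<close>, whence
  \<open>F w - F v \<le> - f w (w - v) + L/2 (w - v)\<^sup>2\<close> (\<open>potential_increment_le\<close>).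
  Testing the scheme with \<open>\<delta>\<close> and adding both parts gives
  \<open>E w - E v \<le> - (1/\<tau> - \<kappa> - L/2) \<parallel>\<delta>\<parallel>\<^sup>2\<close> (\<open>ess1_adjoint_energy_increment_le\<close>), and the time step
  restriction makes the bracket nonnegative.
\<close>

lemma grid_inner_add_left:
  assumes "v \<in> carrier_mat M M" "w \<in> carrier_mat M M"
  shows "grid_inner M (v + w) z = grid_inner M v z + grid_inner M w z"
  using assms
  by (simp add: grid_inner_def distrib_left distrib_right sum.distrib)

lemma grid_inner_smult_left:
  assumes "v \<in> carrier_mat M M"
  shows "grid_inner M (c \<cdot>\<^sub>m v) z = c * grid_inner M v z"
  using assms
  by (simp add: grid_inner_def sum_distrib_left mult.assoc mult.left_commute)

lemma grid_inner_diff_right: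
  assumes "v \<in> carrier_mat M M" "w \<in> carrier_mat M M"
  shows "grid_inner M z (v - w) = grid_inner M z v - grid_inner M z w"
  using assms
  by (simp add: grid_inner_def right_diff_distrib sum_subtractf)

lemma grid_inner_commute: "grid_inner M v w = grid_inner M w v"
  by (simp add: grid_inner_def mult.commute)

lemma grid_inner_self_nonneg: "grid_inner M v v \<ge> 0"
  by (simp add: grid_inner_def sum_nonneg)

lemma index_mult_mat_sum:
  assumes "A \<in> carrier_mat n n" "B \<in> carrier_mat n n" "i < n" "j < n"
  shows "(A * B) $$ (i, j) = (\<Sum>k<n. A $$ (i, k) * B $$ (k, j))"
  using assms by (simp add: scalar_prod_def lessThan_atLeast0)

lemma mult_square_carrier [simp]:
  "A \<in> carrier_mat n n \<Longrightarrow> B \<in> carrier_mat n n \<Longrightarrow> A * B \<in> carrier_mat n n"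
  by (rule mult_carrier_mat)

lemma grid_inner_mult_left:
  assumes "D \<in> carrier_mat M M" "v \<in> carrier_mat M M" "w \<in> carrier_mat M M"
  shows "grid_inner M (transpose_mat D * v) w = grid_inner M v (D * w)"
proof -
  have "(\<Sum>i<M. \<Sum>j<M. (transpose_mat D * v) $$ (i, j) * w $$ (i, j))
      = (\<Sum>i<M. \<Sum>j<M. \<Sum>k<M. D $$ (k, i) * v $$ (k, j) * w $$ (i, j))"
    using assms by (simp add: index_mult_mat_sum[of _ M] sum_distrib_right del: index_mult_mat)
  also have "\<dots> = (\<Sum>i<M. \<Sum>k<M. \<Sum>j<M. D $$ (k, i) * v $$ (k, j) * w $$ (i, j))"
    by (intro sum.cong refl sum.swap)
  also have "\<dots> = (\<Sum>k<M. \<Sum>i<M. \<Sum>j<M. D $$ (k, i) * v $$ (k, j) * w $$ (i, j))"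
    by (rule sum.swap)
  also have "\<dots> = (\<Sum>k<M. \<Sum>j<M. \<Sum>i<M. D $$ (k, i) * v $$ (k, j) * w $$ (i, j))"
    by (intro sum.cong refl sum.swap)
  also have "\<dots> = (\<Sum>k<M. \<Sum>j<M. v $$ (k, j) * (D * w) $$ (k, j))"
    using assms
    by (simp add: index_mult_mat_sum[of _ M] sum_distrib_left mult_ac del: index_mult_mat)
  finally show ?thesis by (simp add: grid_inner_def)
qed

lemma grid_inner_mult_right:
  assumes "D \<in> carrier_mat M M" "v \<in> carrier_mat M M" "w \<in> carrier_mat M M"
  shows "grid_inner M (v * D) w = grid_inner M v (w * transpose_mat D)"
proof -
  have "(\<Sum>i<M. \<Sum>j<M. (v * D) $$ (i, j) * w $$ (i, j))
      = (\<Sum>i<M. \<Sum>j<M. \<Sum>k<M. v $$ (i, k) * D $$ (k, j) * w $$ (i, j))"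
    using assms by (simp add: index_mult_mat_sum[of _ M] sum_distrib_right del: index_mult_mat)
  also have "\<dots> = (\<Sum>i<M. \<Sum>k<M. \<Sum>j<M. v $$ (i, k) * D $$ (k, j) * w $$ (i, j))"
    by (intro sum.cong refl sum.swap)
  also have "\<dots> = (\<Sum>i<M. \<Sum>k<M. v $$ (i, k) * (w * transpose_mat D) $$ (i, k))"
    using assms
    by (simp add: index_mult_mat_sum[of _ M] sum_distrib_left mult_ac del: index_mult_mat)
  finally show ?thesis by (simp add: grid_inner_def)
qed

lemma D_a_carrier [simp]: "D_a M \<in> carrier_mat M M"
  by (simp add: D_a_def)

lemma D_a_dim [simp]: "dim_row (D_a M) = M" "dim_col (D_a M) = M"
  by (simp_all add: D_a_def)

lemma Delta_a_carrier [simp]: "v \<in> carrier_mat M M \<Longrightarrow> Delta_a M v \<in> carrier_mat M M"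
  unfolding Delta_a_def by simp

lemma Delta_b_carrier [simp]: "v \<in> carrier_mat M M \<Longrightarrow> Delta_b M v \<in> carrier_mat M M"
  unfolding Delta_b_def D_b_def by simp

lemma Delta_b_adjoint:
  assumes "v \<in> carrier_mat M M" "w \<in> carrier_mat M M"
  shows "grid_inner M (Delta_b M v) w = grid_inner M (Delta_a M w) v"
proof -
  have "grid_inner M (Delta_b M v) w
      = grid_inner M (transpose_mat (D_a M) * v) w + grid_inner M (v * D_a M) w"
    unfolding Delta_b_def D_b_def using assms by (simp add: grid_inner_add_left)
  also have "\<dots> = grid_inner M (D_a M * w) v + grid_inner M (w * transpose_mat (D_a M)) v"
    unfolding grid_inner_mult_left[OF D_a_carrier assms] grid_inner_mult_right[OF D_a_carrier assms]
    by (simp only: grid_inner_commute[of M v])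
  also have "\<dots> = grid_inner M (Delta_a M w) v"
    unfolding Delta_a_def using assms by (simp add: grid_inner_add_left)
  finally show ?thesis .
qed

text \<open>
  The mixed terms \<open>\<langle>\<Delta>\<^sub>a w, v\<rangle>\<close> and \<open>\<langle>\<Delta>\<^sub>b v, w\<rangle>\<close> agree by adjointness, and so do
  \<open>\<langle>\<Delta>\<^sub>b v, v\<rangle>\<close> and \<open>\<langle>\<Delta>\<^sub>a v, v\<rangle>\<close>.
\<close>

lemma Delta_telescope:
  assumes "v \<in> carrier_mat M M" "w \<in> carrier_mat M M"
  shows "grid_inner M (Delta_a M w + Delta_b M v) (w - v)
       = grid_inner M (Delta_a M w) w - grid_inner M (Delta_a M v) v"
  using assms by (simp add: grid_inner_add_left grid_inner_diff_right Delta_b_adjoint)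

lemma D_a_row_sum:
  assumes "i < M"
  shows "(mesh M)\<^sup>2 * (\<Sum>k<M. D_a M $$ (i, k) * x k)
       = (if i + 1 < M then x (i + 1) else 0) + (if i = 0 then x (M - 1) else 0) - x i"
proof -
  have "mesh M \<noteq> 0" using assms by (simp add: mesh_def)
  then have "(mesh M)\<^sup>2 * (\<Sum>k<M. D_a M $$ (i, k) * x k)
      = (\<Sum>k<M. (if k = i + 1 then x k else 0) + (if k = M - 1 then if i = 0 then x k else 0 else 0)
           - (if k = i then x k else 0))"
    unfolding sum_distrib_left
    by (intro sum.cong refl) (use assms in \<open>auto simp: D_a_def\<close>)
  also have "\<dots> = (if i + 1 < M then x (i + 1) else 0) + (if i = 0 then x (M - 1) else 0) - x i"
    using assms by (simp add: sum.distrib sum_subtractf)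
  finally show ?thesis .
qed

lemma sum_cyclic:
  fixes g :: "nat \<Rightarrow> nat \<Rightarrow> real"
  assumes "M > 0"
  shows "(\<Sum>i<M. g i ((i + 1) mod M)) = (\<Sum>i<M - 1. g i (i + 1)) + g (M - 1) 0"
proof -
  obtain m where m: "M = Suc m" using assms gr0_implies_Suc by blast
  show ?thesis unfolding m by simp
qed

text \<open>
  Although \<^const>\<open>D_a\<close> is not the periodic forward difference, its quadratic form is that of half the
  periodic second difference: the corner entry pairs \<open>x (M - 1)\<close> with \<open>x 0\<close>, closing up the
  products of neighbours to a cycle.
\<close>

lemma cyclic_difference_sum_squares:
  fixes x :: "nat \<Rightarrow> real"
  assumes "M > 0"
  shows "(\<Sum>i<M. (x ((i + 1) mod M) - x i)\<^sup>2)
       = - 2 * (mesh M)\<^sup>2 * (\<Sum>i<M. (\<Sum>k<M. D_a M $$ (i, k) * x k) * x i)"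
proof -
  obtain m where m: "M = Suc m" using assms gr0_implies_Suc by blast
  have shift: "(\<Sum>i<M. (x ((i + 1) mod M))\<^sup>2) = (\<Sum>i<M. (x i)\<^sup>2)"
    unfolding sum_cyclic[OF assms, of "\<lambda>i j. (x j)\<^sup>2"] unfolding m
    by (simp add: sum.lessThan_Suc_shift del: sum.lessThan_Suc)
  have "(mesh M)\<^sup>2 * (\<Sum>i<M. (\<Sum>k<M. D_a M $$ (i, k) * x k) * x i)
      = (\<Sum>i<M. ((mesh M)\<^sup>2 * (\<Sum>k<M. D_a M $$ (i, k) * x k)) * x i)"
    by (subst sum_distrib_left) (simp only: mult.assoc)
  also have "\<dots> = (\<Sum>i<M. (if i + 1 < M then x i * x (i + 1) else 0)
      + (if i = 0 then x i * x (M - 1) else 0) - (x i)\<^sup>2)"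
    by (intro sum.cong refl, subst D_a_row_sum)
      (auto simp: algebra_simps power2_eq_square)
  also have "\<dots> = (\<Sum>i<M - 1. x i * x (i + 1)) + x (M - 1) * x 0 - (\<Sum>i<M. (x i)\<^sup>2)"
    unfolding m by (simp add: sum.distrib sum_subtractf)
  also have "\<dots> = (\<Sum>i<M. x i * x ((i + 1) mod M)) - (\<Sum>i<M. (x i)\<^sup>2)"
    using sum_cyclic[OF assms, of "\<lambda>i j. x i * x j"] by simp
  finally have quad: "(mesh M)\<^sup>2 * (\<Sum>i<M. (\<Sum>k<M. D_a M $$ (i, k) * x k) * x i)
      = (\<Sum>i<M. x i * x ((i + 1) mod M)) - (\<Sum>i<M. (x i)\<^sup>2)" .
  have "(\<Sum>i<M. (x ((i + 1) mod M) - x i)\<^sup>2)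
      = (\<Sum>i<M. (x ((i + 1) mod M))\<^sup>2) + (\<Sum>i<M. (x i)\<^sup>2)
        - 2 * (\<Sum>i<M. x i * x ((i + 1) mod M))"
    by (simp add: power2_diff sum.distrib sum_subtractf sum_distrib_left mult_ac)
  with shift quad show ?thesis by simp
qed

lemma grid_gradient_norm_eq:
  assumes "M > 0" and v: "v \<in> carrier_mat M M"
  shows "(grid_pair_norm M (grid_gradient M v))\<^sup>2 = - 2 * grid_inner M (Delta_a M v) v"
proof -
  have h: "mesh M \<noteq> 0" using assms by (simp add: mesh_def)
  have rows: "grid_inner M (fst (grid_gradient M v)) (fst (grid_gradient M v))
      = - 2 * grid_inner M (D_a M * v) v"
  proof -
    have "grid_inner M (fst (grid_gradient M v)) (fst (grid_gradient M v))
        = (\<Sum>i<M. \<Sum>j<M. (v $$ ((i + 1) mod M, j) - v $$ (i, j))\<^sup>2)"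
      using h by (simp add: grid_inner_def grid_gradient_def sum_distrib_left
          power2_eq_square)
    also have "\<dots> = (\<Sum>j<M. \<Sum>i<M. (v $$ ((i + 1) mod M, j) - v $$ (i, j))\<^sup>2)"
      by (rule sum.swap)
    also have "\<dots> = - 2 * (mesh M)\<^sup>2 *
        (\<Sum>j<M. \<Sum>i<M. (\<Sum>k<M. D_a M $$ (i, k) * v $$ (k, j)) * v $$ (i, j))"
      using cyclic_difference_sum_squares[OF \<open>M > 0\<close>, of "\<lambda>i. v $$ (i, _)"]
      by (simp add: sum_distrib_left)
    also have "\<dots> = - 2 * (mesh M)\<^sup>2 *
        (\<Sum>i<M. \<Sum>j<M. (\<Sum>k<M. D_a M $$ (i, k) * v $$ (k, j)) * v $$ (i, j))"
      by (subst sum.swap) simp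
    finally show ?thesis
      using v by (simp add: grid_inner_def index_mult_mat_sum[of _ M] del: index_mult_mat)
  qed
  have columns: "grid_inner M (snd (grid_gradient M v)) (snd (grid_gradient M v))
      = - 2 * grid_inner M (v * transpose_mat (D_a M)) v"
  proof -
    have "grid_inner M (snd (grid_gradient M v)) (snd (grid_gradient M v))
        = (\<Sum>i<M. \<Sum>j<M. (v $$ (i, (j + 1) mod M) - v $$ (i, j))\<^sup>2)"
      using h by (simp add: grid_inner_def grid_gradient_def sum_distrib_left
          power2_eq_square)
    also have "\<dots> = - 2 * (mesh M)\<^sup>2 *
        (\<Sum>i<M. \<Sum>j<M. (\<Sum>k<M. D_a M $$ (j, k) * v $$ (i, k)) * v $$ (i, j))"
      using cyclic_difference_sum_squares[OF \<open>M > 0\<close>, of "\<lambda>j. v $$ (_, j)"]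
      by (simp add: sum_distrib_left)
    finally show ?thesis
      using v by (simp add: grid_inner_def index_mult_mat_sum[of _ M] mult.commute[of "v $$ _"]
          del: index_mult_mat)
  qed
  have "(grid_pair_norm M (grid_gradient M v))\<^sup>2
      = grid_inner M (fst (grid_gradient M v)) (fst (grid_gradient M v))
      + grid_inner M (snd (grid_gradient M v)) (snd (grid_gradient M v))"
    by (simp add: grid_pair_norm_def grid_norm_def grid_inner_self_nonneg)
  also have "\<dots> = - 2 * grid_inner M (Delta_a M v) v"
    unfolding rows columns Delta_a_def using v by (simp add: grid_inner_add_left)
  finally show ?thesis .
qed

lemma grid_energy_eq:
  assumes "M > 0" and v: "v \<in> carrier_mat M M"
  shows "grid_energy M \<epsilon> F v
       = - \<epsilon>\<^sup>2 * grid_inner M (Delta_a M v) v + (mesh M)\<^sup>2 * (\<Sum>i<M. \<Sum>j<M. F (v $$ (i, j)))"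
  using v by (simp add: grid_energy_def grid_gradient_norm_eq[OF assms])
    (simp add: grid_inner_def)

text \<open>
  Adding \<open>f y (x - y) + L/2 (x - y)\<^sup>2\<close> to \<open>F x\<close> gives a function of \<open>x\<close> whose derivative
  \<open>f y - f x + L (x - y)\<close> has the sign of \<open>x - y\<close>, so \<open>x = y\<close> is its minimum.
\<close>

lemma potential_increment_le:
  fixes f F :: "real \<Rightarrow> real"
  assumes lip: "\<And>s t. s \<in> {a..b} \<Longrightarrow> t \<in> {a..b} \<Longrightarrow> \<bar>f s - f t\<bar> \<le> L * \<bar>s - t\<bar>"
    and F: "\<And>s. s \<in> {a..b} \<Longrightarrow> (F has_real_derivative - f s) (at s within {a..b})"
    and x: "x \<in> {a..b}" and y: "y \<in> {a..b}"
  shows "F y - F x \<le> - f y * (y - x) + L / 2 * (y - x)\<^sup>2"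
proof -
  define \<phi> where "\<phi> s = F s + f y * (s - y) + L / 2 * (s - y)\<^sup>2" for s
  define \<phi>' where "\<phi>' s = f y - f s + L * (s - y)" for s
  have deriv: "(\<phi> has_derivative (*) (\<phi>' s)) (at s within {c..d})"
    if "s \<in> {c..d}" "{c..d} \<subseteq> {a..b}" for s c d
  proof -
    have "(F has_real_derivative - f s) (at s within {c..d})"
      using F that by (meson DERIV_subset subsetD)
    then have "(\<phi> has_real_derivative \<phi>' s) (at s within {c..d})"
      unfolding \<phi>_def \<phi>'_def by (auto intro!: derivative_eq_intros)
    then show ?thesis by (simp add: has_field_derivative_def)
  qed
  have "\<phi> y \<le> \<phi> x"
  proof (cases x y rule: linorder_cases)
    case less
    then obtain s where s: "s \<in> {x<..<y}" "\<phi> y - \<phi> x = \<phi>' s * (y - x)"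
      using mvt_simple[of x y \<phi> "\<lambda>s. (*) (\<phi>' s)"] deriv x y by auto
    have "\<phi>' s \<le> 0" using lip[of s y] s x y by (auto simp: \<phi>'_def abs_if algebra_simps split: if_splits)
    then have "\<phi>' s * (y - x) \<le> 0" using less by (intro mult_nonpos_nonneg) auto
    with s show ?thesis by simp
  next
    case greater
    then obtain s where s: "s \<in> {y<..<x}" "\<phi> x - \<phi> y = \<phi>' s * (x - y)"
      using mvt_simple[of y x \<phi> "\<lambda>s. (*) (\<phi>' s)"] deriv x y by auto
    have "\<phi>' s \<ge> 0" using lip[of s y] s x y by (auto simp: \<phi>'_def abs_if algebra_simps split: if_splits)
    then have "\<phi>' s * (x - y) \<ge> 0" using greater by (intro mult_nonneg_nonneg) auto
    with s show ?thesis by simp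
  qed simp
  then show ?thesis by (simp add: \<phi>_def algebra_simps power2_commute[of x y])
qed

text \<open>
  Both the scheme and the expansion of \<open>F\<close> are centred at the new value \<open>w\<close>, so testing the scheme
  with \<open>w - v\<close> cancels all first-order terms; only multiples of \<open>\<parallel>w - v\<parallel>\<^sup>2\<close> survive.
\<close>

lemma ess1_adjoint_energy_increment_le:
  assumes "M > 0" and v: "v \<in> carrier_mat M M"
    and v_bound: "\<And>i j. i < M \<Longrightarrow> j < M \<Longrightarrow> v $$ (i, j) \<in> {-\<beta>..\<beta>}"
    and step: "ess1_adjoint_step M \<epsilon> f \<beta> \<kappa> \<tau> v w"
    and lip: "\<And>s t. s \<in> {-\<beta>..\<beta>} \<Longrightarrow> t \<in> {-\<beta>..\<beta>} \<Longrightarrow> \<bar>f s - f t\<bar> \<le> L * \<bar>s - t\<bar>"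
    and F: "\<And>s. s \<in> {-\<beta>..\<beta>} \<Longrightarrow> (F has_real_derivative - f s) (at s within {-\<beta>..\<beta>})"
  shows "grid_energy M \<epsilon> F w - grid_energy M \<epsilon> F v
       \<le> - (1 / \<tau> - \<kappa> - L / 2) * grid_inner M (w - v) (w - v)"
proof -
  define \<delta> where "\<delta> = w - v"
  have w: "w \<in> carrier_mat M M"
    and w_bound: "\<And>i j. i < M \<Longrightarrow> j < M \<Longrightarrow> w $$ (i, j) \<in> {-\<beta>..\<beta>}"
    and scheme: "(1 / \<tau>) \<cdot>\<^sub>m \<delta> = \<epsilon>\<^sup>2 \<cdot>\<^sub>m (Delta_a M w + Delta_b M v) + map_mat f w + \<kappa> \<cdot>\<^sub>m \<delta>"
    using step by (auto simp: ess1_adjoint_step_def \<delta>_def)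
  have \<delta>: "\<delta> \<in> carrier_mat M M" unfolding \<delta>_def using v w by (intro minus_carrier_mat)
  have "1 / \<tau> * grid_inner M \<delta> \<delta> = grid_inner M ((1 / \<tau>) \<cdot>\<^sub>m \<delta>) \<delta>"
    using \<delta> by (simp only: grid_inner_smult_left)
  also have "\<dots> = \<epsilon>\<^sup>2 * grid_inner M (Delta_a M w + Delta_b M v) \<delta>
      + grid_inner M (map_mat f w) \<delta> + \<kappa> * grid_inner M \<delta> \<delta>"
    unfolding scheme using v w \<delta>
    by (subst grid_inner_add_left grid_inner_smult_left, simp, simp)+ simp
  finally have tested: "1 / \<tau> * grid_inner M \<delta> \<delta>
      = \<epsilon>\<^sup>2 * (grid_inner M (Delta_a M w) w - grid_inner M (Delta_a M v) v)
      + grid_inner M (map_mat f w) \<delta> + \<kappa> * grid_inner M \<delta> \<delta>"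
    unfolding \<delta>_def Delta_telescope[OF v w] .
  have "(\<Sum>i<M. \<Sum>j<M. F (w $$ (i, j))) - (\<Sum>i<M. \<Sum>j<M. F (v $$ (i, j)))
      = (\<Sum>i<M. \<Sum>j<M. F (w $$ (i, j)) - F (v $$ (i, j)))"
    by (simp add: sum_subtractf)
  also have "\<dots> \<le> (\<Sum>i<M. \<Sum>j<M. - f (w $$ (i, j)) * (w $$ (i, j) - v $$ (i, j))
      + L / 2 * (w $$ (i, j) - v $$ (i, j))\<^sup>2)"
    using v_bound w_bound by (intro sum_mono potential_increment_le[OF lip F]) auto
  also have "\<dots> = - (\<Sum>i<M. \<Sum>j<M. map_mat f w $$ (i, j) * \<delta> $$ (i, j))
      + L / 2 * (\<Sum>i<M. \<Sum>j<M. \<delta> $$ (i, j) * \<delta> $$ (i, j))"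
    using v w by (simp add: \<delta>_def sum.distrib sum_subtractf sum_negf sum_distrib_left
        power2_eq_square)
  finally have "(mesh M)\<^sup>2 * ((\<Sum>i<M. \<Sum>j<M. F (w $$ (i, j))) - (\<Sum>i<M. \<Sum>j<M. F (v $$ (i, j))))
      \<le> (mesh M)\<^sup>2 * \<dots>"
    by (intro mult_left_mono) auto
  also have "\<dots> = - grid_inner M (map_mat f w) \<delta> + L / 2 * grid_inner M \<delta> \<delta>"
    by (simp add: grid_inner_def algebra_simps)
  finally have "(mesh M)\<^sup>2 * ((\<Sum>i<M. \<Sum>j<M. F (w $$ (i, j))) - (\<Sum>i<M. \<Sum>j<M. F (v $$ (i, j))))
      \<le> - grid_inner M (map_mat f w) \<delta> + L / 2 * grid_inner M \<delta> \<delta>" .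
  with tested show ?thesis
    unfolding grid_energy_eq[OF \<open>M > 0\<close> v] grid_energy_eq[OF \<open>M > 0\<close> w] \<delta>_def[symmetric]
    by (simp add: algebra_simps)
qed

lemma interval_sup_norm_upper:
  assumes "continuous_on {-\<beta>..\<beta>} g" "x \<in> {-\<beta>..\<beta>}"
  shows "\<bar>g x\<bar> \<le> interval_sup_norm \<beta> g"
  unfolding interval_sup_norm_def
proof (rule cSUP_upper[OF assms(2)])
  have "compact ((\<lambda>x. \<bar>g x\<bar>) ` {-\<beta>..\<beta>})"
    using assms by (intro compact_continuous_image continuous_intros) auto
  then show "bdd_above ((\<lambda>x. \<bar>g x\<bar>) ` {-\<beta>..\<beta>})"
    by (intro bounded_imp_bdd_above compact_imp_bounded)
qed

lemma lipschitz_interval_sup_norm: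
  assumes "\<And>x. x \<in> {-\<beta>..\<beta>} \<Longrightarrow> (f has_real_derivative f' x) (at x within {-\<beta>..\<beta>})"
    and "continuous_on {-\<beta>..\<beta>} f'" and "s \<in> {-\<beta>..\<beta>}" "t \<in> {-\<beta>..\<beta>}"
  shows "\<bar>f s - f t\<bar> \<le> interval_sup_norm \<beta> f' * \<bar>s - t\<bar>"
  using field_differentiable_bound[of "{-\<beta>..\<beta>}" f f' "interval_sup_norm \<beta> f'" s t]
    assms interval_sup_norm_upper[OF assms(2)] by auto

lemma max_time_step_bound:
  assumes "0 < \<tau>" "\<tau> \<le> max_time_step M \<epsilon> \<kappa> L" "\<kappa> \<ge> 0" "L \<ge> 0"
  shows "\<kappa> + L \<le> 1 / \<tau>"
proof (cases "\<kappa> + L = 0")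
  case False
  then have "\<kappa> + L > 0" "\<tau> \<le> 1 / (\<kappa> + L)"
    using assms by (auto simp: max_time_step_def Let_def)
  with \<open>0 < \<tau>\<close> show ?thesis by (simp add: field_simps)
qed (use assms in simp)

lemma grid_sup_norm_entry:
  assumes "grid_sup_norm M v \<le> \<beta>" "i < M" "j < M"
  shows "v $$ (i, j) \<in> {-\<beta>..\<beta>}"
proof -
  have "\<bar>v $$ (i, j)\<bar> \<le> grid_sup_norm M v"
    unfolding grid_sup_norm_def using assms by (intro Max_ge) force+
  with assms show ?thesis by auto
qed

theorem theorem3p6:
  fixes M :: nat and \<epsilon> T \<beta> \<kappa> \<tau> :: real and f f' F :: "real \<Rightarrow> real"
    and u0 :: "real mat" and u :: "nat \<Rightarrow> real mat"
  assumes "M > 0" and "\<epsilon> > 0" and "T > 0" and "\<beta> > 0" and "\<kappa> \<ge> 0"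
    and f_deriv: "\<And>x. x \<in> {-\<beta>..\<beta>} \<Longrightarrow> (f has_real_derivative f' x) (at x within {-\<beta>..\<beta>})"
    and f'_cont: "continuous_on {-\<beta>..\<beta>} f'"
    and f_odd: "\<And>x. x \<in> {-\<beta>..\<beta>} \<Longrightarrow> f (- x) = - f x"
    and f_beta: "f \<beta> = 0"
    and F_deriv: "\<And>x. x \<in> {-\<beta>..\<beta>} \<Longrightarrow> (F has_real_derivative - f x) (at x within {-\<beta>..\<beta>})"
    and u0_grid: "u0 \<in> carrier_mat M M" and u0_bound: "grid_sup_norm M u0 \<le> \<beta>"
    and tau: "0 < \<tau>" "\<tau> \<le> max_time_step M \<epsilon> \<kappa> (interval_sup_norm \<beta> f')"
    and sol: "ess1_adjoint_solution M \<epsilon> f \<beta> \<kappa> \<tau> (nat \<lfloor>T / \<tau>\<rfloor>) u0 u"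
  shows "\<forall>n < nat \<lfloor>T / \<tau>\<rfloor>. grid_energy M \<epsilon> F (u (Suc n)) \<le> grid_energy M \<epsilon> F (u n)"
proof (intro allI impI)
  fix n assume n: "n < nat \<lfloor>T / \<tau>\<rfloor>"
  define L where "L = interval_sup_norm \<beta> f'"
  have step: "ess1_adjoint_step M \<epsilon> f \<beta> \<kappa> \<tau> (u m) (u (Suc m))" if "m < nat \<lfloor>T / \<tau>\<rfloor>" for m
    using sol that by (simp add: ess1_adjoint_solution_def)
  have un: "u n \<in> carrier_mat M M \<and> (\<forall>i<M. \<forall>j<M. u n $$ (i, j) \<in> {-\<beta>..\<beta>})"
  proof (cases n)
    case 0
    then show ?thesis
      using sol u0_grid grid_sup_norm_entry[OF u0_bound] by (simp add: ess1_adjoint_solution_def)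
  next
    case (Suc m)
    then show ?thesis using step[of m] n by (simp add: ess1_adjoint_step_def)
  qed
  have "L \<ge> 0"
    using interval_sup_norm_upper[OF f'_cont, of 0] \<open>\<beta> > 0\<close> by (simp add: L_def)
  then have "1 / \<tau> - \<kappa> - L / 2 \<ge> 0"
    using max_time_step_bound[OF tau \<open>\<kappa> \<ge> 0\<close>] by (simp add: L_def)
  then have "(1 / \<tau> - \<kappa> - L / 2) * grid_inner M (u (Suc n) - u n) (u (Suc n) - u n) \<ge> 0"
    by (intro mult_nonneg_nonneg grid_inner_self_nonneg)
  moreover have "grid_energy M \<epsilon> F (u (Suc n)) - grid_energy M \<epsilon> F (u n)
      \<le> - (1 / \<tau> - \<kappa> - L / 2) * grid_inner M (u (Suc n) - u n) (u (Suc n) - u n)"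
    using un lipschitz_interval_sup_norm[OF f_deriv f'_cont] F_deriv
    by (intro ess1_adjoint_energy_increment_le[OF \<open>M > 0\<close> _ _ step[OF n]]) (auto simp: L_def)
  ultimately show "grid_energy M \<epsilon> F (u (Suc n)) \<le> grid_energy M \<epsilon> F (u n)"
    by (simp only: mult_minus_left)
qed

end
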